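(* Suppose that $p,q\in[2,\infty]$ satisfy $p>q$. Then there does not exist a regular AM-map (at infinity) from $\ell_p$ to a metric space with sharp metric cotype $q$.
   Context: Metric spaces with a point at infinity. An unbounded metric space $(M,d)$ is regarded as $X=M\cup\{*_X\}$ with $d(x,*_X)=\infty$ for $x\in M$, $d( *_X,*_X)=0$; the points of $M$ are the finite points. A finite point $o$ is chosen as origin and $|x|=d(o,x)$. Topology on $X$: base given by open balls of $M$ and the sets $\{*_X\}\cup(M\setminus\overline{B(x,r)})$, $x\in M$, $r>0$. A map from $M$ to $M'$, with origins $o,o'$, means a map $f:M\cup\{*_X\}\to M'\cup\{*_Y\}$ with $f( *_X)=*_Y$ and $f(o)=o'$. Cross ratio. For $x\ne w$, $y\ne z$ finite, $[x,y,z,w]=\frac{d(x,z)d(y,w)}{d(x,w)d(y,z)}$. If $x=z$ or $y=w$ it is $0$ (even if some points are at infinity); otherwise factors containing the point at infinity are omitted, e.g. $[x,y,z,*_X]=d(x,z)/d(y,z)$. Admissible gauge: nondecreasing $u:\mathbb R_+\to\mathbb R$ with $\limsup_{r\to\infty}u(r)/r=0$. Finite points $x,y$ are separated by $u$ if $d(x,y)>u(|x|+|y|)$; every finite point is separated from $*_X$. AM-map at infinity: there are an admissible gauge $u$ and a homeomorphism $\eta:[0,\infty)\to[0,\infty)$ with $[f(x),f(y),f(z),f(w)]<\eta([x,y,z,w])$ for all $x,y,z,w\in X$ pairwise separated by $u$ (the condition includes that the cross ratios involved are defined). Regular: $f$ is continuous at $*_X$ and for every neighborhood $V$ of $*_X$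 there is a neighborhood $U$ of $*_Y$ with $f^{-1}(U)\subset V$. Metric cotype. A metric space $(M,d)$ has metric cotype $q>0$ with constant $C$ if for every $n\in\mathbb N$ there is an even integer $m$ such that every $h:\mathbb Z_m^n\to M$ satisfies $$\sum_{j=1}^n\mathbb E_x\big[d(h(x+\tfrac m2e_j),h(x))^q\big]\le C^qm^q\,\mathbb E_{\varepsilon,x}\big[d(h(x+\varepsilon),h(x))^q\big],$$ with $x\in\mathbb Z_m^n$ and $\varepsilon\in\{-1,0,1\}^n$ uniformly distributed and $e_j$ the standard basis vectors. A non-singleton $(M,d)$ has sharp metric cotype $q$ if this holds with $C$ bounded by a constant depending only on $q$ and $M$, and with $m=m(n)\le A\,n^{1/q}$ for a constant $A$ depending only on $q$ and $M$. *)

theory Defs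
  imports "HOL-Analysis.Analysis"
begin

text \<open>Metric spaces are given by a carrier \<open>M\<close> and a distance \<open>d\<close> as in
  \<^locale>\<open>Metric_space\<close>. A space with its point at infinity lives in an option type: \<open>None\<close> is the
  point at infinity and \<open>Some x\<close>, \<open>x \<in> M\<close>, are the finite points.\<close>

definition with_infinity :: "'a set \<Rightarrow> 'a option set" where
  "with_infinity M = insert None (Some ` M)"

definition infinity_topology :: "'a set \<Rightarrow> ('a \<Rightarrow> 'a \<Rightarrow> real) \<Rightarrow> 'a option topology" where
  "infinity_topology M d = topology_generated_by
     ({Some ` Metric_space.mball M d x r | x r. x \<in> M \<and> r > 0} \<union>
      {insert None (Some ` (M - Metric_space.mtopology M d closure_of Metric_space.mball M d x r))
        | x r. x \<in> M \<and> r > 0})"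

text \<open>Distance factors containing the point at infinity are omitted from a cross ratio,
  so they count as 1.\<close>

fun dist_factor :: "('a \<Rightarrow> 'a \<Rightarrow> real) \<Rightarrow> 'a option \<Rightarrow> 'a option \<Rightarrow> real" where
  "dist_factor d (Some x) (Some y) = d x y"
| "dist_factor d _ _ = 1"

definition cross_ratio_defined :: "'a option \<Rightarrow> 'a option \<Rightarrow> 'a option \<Rightarrow> 'a option \<Rightarrow> bool" where
  "cross_ratio_defined x y z w \<longleftrightarrow> x \<noteq> w \<and> y \<noteq> z"

text \<open>Meaningful only where \<^const>\<open>cross_ratio_defined\<close> holds.\<close>

definition cross_ratio ::
  "('a \<Rightarrow> 'a \<Rightarrow> real) \<Rightarrow> 'a option \<Rightarrow> 'a option \<Rightarrow> 'a option \<Rightarrow> 'a option \<Rightarrow> real" where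
  "cross_ratio d x y z w =
     (if x = z \<or> y = w then 0
      else (dist_factor d x z * dist_factor d y w) / (dist_factor d x w * dist_factor d y z))"

text \<open>Gauges are functions on \<open>[0,\<infinity>)\<close>; their values at negative arguments are irrelevant.\<close>

definition admissible_gauge :: "(real \<Rightarrow> real) \<Rightarrow> bool" where
  "admissible_gauge u \<longleftrightarrow> mono_on {0..} u \<and> Limsup at_top (\<lambda>r. ereal (u r / r)) = 0"

text \<open>\<open>a\<close> is the origin, so \<open>d a x\<close> is the modulus of \<open>x\<close>. The point at infinity is separated
  from every finite point, but not from itself.\<close>

fun separated_by ::
  "('a \<Rightarrow> 'a \<Rightarrow> real) \<Rightarrow> 'a \<Rightarrow> (real \<Rightarrow> real) \<Rightarrow> 'a option \<Rightarrow> 'a option \<Rightarrow> bool" where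
  "separated_by d a u (Some x) (Some y) \<longleftrightarrow> d x y > u (d a x + d a y)"
| "separated_by d a u (Some x) None \<longleftrightarrow> True"
| "separated_by d a u None (Some y) \<longleftrightarrow> True"
| "separated_by d a u None None \<longleftrightarrow> False"

definition pairwise_separated4 ::
  "('a \<Rightarrow> 'a \<Rightarrow> real) \<Rightarrow> 'a \<Rightarrow> (real \<Rightarrow> real) \<Rightarrow>
   'a option \<Rightarrow> 'a option \<Rightarrow> 'a option \<Rightarrow> 'a option \<Rightarrow> bool" where
  "pairwise_separated4 d a u x y z w \<longleftrightarrow>
     separated_by d a u x y \<and> separated_by d a u x z \<and> separated_by d a u x w \<and>
     separated_by d a u y z \<and> separated_by d a u y w \<and> separated_by d a u z w"

definition pointed_map :: "'a set \<Rightarrow> 'a \<Rightarrow> 'b set \<Rightarrow> 'b \<Rightarrow> ('a option \<Rightarrow> 'b option) \<Rightarrow> bool" where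
  "pointed_map M a N b f \<longleftrightarrow>
     f ` with_infinity M \<subseteq> with_infinity N \<and> f None = None \<and> f (Some a) = Some b"

definition AM_map ::
  "'a set \<Rightarrow> ('a \<Rightarrow> 'a \<Rightarrow> real) \<Rightarrow> 'a \<Rightarrow> 'b set \<Rightarrow> ('b \<Rightarrow> 'b \<Rightarrow> real) \<Rightarrow> 'b \<Rightarrow>
   ('a option \<Rightarrow> 'b option) \<Rightarrow> bool" where
  "AM_map M d a N e b f \<longleftrightarrow> pointed_map M a N b f \<and>
     (\<exists>u \<eta> \<eta>'. admissible_gauge u \<and> homeomorphism {0..} {0..} \<eta> \<eta>' \<and>
        (\<forall>x\<in>with_infinity M. \<forall>y\<in>with_infinity M. \<forall>z\<in>with_infinity M. \<forall>w\<in>with_infinity M.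
           pairwise_separated4 d a u x y z w \<longrightarrow>
             cross_ratio_defined x y z w \<and> cross_ratio_defined (f x) (f y) (f z) (f w) \<and>
             cross_ratio e (f x) (f y) (f z) (f w) < \<eta> (cross_ratio d x y z w)))"

definition regular_map ::
  "'a set \<Rightarrow> ('a \<Rightarrow> 'a \<Rightarrow> real) \<Rightarrow> 'b set \<Rightarrow> ('b \<Rightarrow> 'b \<Rightarrow> real) \<Rightarrow>
   ('a option \<Rightarrow> 'b option) \<Rightarrow> bool" where
  "regular_map M d N e f \<longleftrightarrow>
     topcontinuous_at (infinity_topology M d) (infinity_topology N e) f None \<and>
     (\<forall>V. openin (infinity_topology M d) V \<and> None \<in> V \<longrightarrow>
        (\<exists>U. openin (infinity_topology N e) U \<and> None \<in> U \<and>
           {x \<in> with_infinity M. f x \<in> U} \<subseteq> V))"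

text \<open>The discrete torus: residues modulo \<open>m\<close> are represented in \<open>{0..<m}\<close>, vectors are
  extensional functions on \<open>{..<n}\<close>.\<close>

definition torus :: "nat \<Rightarrow> nat \<Rightarrow> (nat \<Rightarrow> int) set" where
  "torus n m = {..<n} \<rightarrow>\<^sub>E {0..<int m}"

definition sign_vectors :: "nat \<Rightarrow> (nat \<Rightarrow> int) set" where
  "sign_vectors n = {..<n} \<rightarrow>\<^sub>E {-1, 0, 1}"

definition torus_add :: "nat \<Rightarrow> nat \<Rightarrow> (nat \<Rightarrow> int) \<Rightarrow> (nat \<Rightarrow> int) \<Rightarrow> (nat \<Rightarrow> int)" where
  "torus_add n m x v = (\<lambda>i\<in>{..<n}. (x i + v i) mod int m)"

definition average :: "'c set \<Rightarrow> ('c \<Rightarrow> real) \<Rightarrow> real" where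
  "average S g = (\<Sum>s\<in>S. g s) / real (card S)"

definition metric_cotype_ineq ::
  "'a set \<Rightarrow> ('a \<Rightarrow> 'a \<Rightarrow> real) \<Rightarrow> real \<Rightarrow> real \<Rightarrow> nat \<Rightarrow> nat \<Rightarrow> bool" where
  "metric_cotype_ineq M d q C n m \<longleftrightarrow>
     (\<forall>h \<in> torus n m \<rightarrow> M.
        (\<Sum>j<n. average (torus n m)
           (\<lambda>x. d (h (torus_add n m x (\<lambda>i. if i = j then int (m div 2) else 0))) (h x) powr q))
        \<le> C powr q * real m powr q *
          average (sign_vectors n \<times> torus n m)
            (\<lambda>(\<epsilon>, x). d (h (torus_add n m x \<epsilon>)) (h x) powr q))"

definition sharp_metric_cotype :: "'a set \<Rightarrow> ('a \<Rightarrow> 'a \<Rightarrow> real) \<Rightarrow> real \<Rightarrow> bool" where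
  "sharp_metric_cotype M d q \<longleftrightarrow> (\<exists>x\<in>M. \<exists>y\<in>M. x \<noteq> y) \<and> q > 0 \<and>
     (\<exists>C>0. \<exists>A. \<forall>n\<ge>1. \<exists>m>0. even m \<and> real m \<le> A * real n powr (1 / q) \<and>
        metric_cotype_ineq M d q C n m)"

text \<open>Real sequence spaces \<open>\<ell>\<^sub>p\<close> for \<open>1 \<le> p \<le> \<infinity>\<close>.\<close>

definition lp_space :: "ereal \<Rightarrow> (nat \<Rightarrow> real) set" where
  "lp_space p = {x. if p = \<infinity> then bounded (range x)
                    else summable (\<lambda>n. \<bar>x n\<bar> powr real_of_ereal p)}"

definition lp_norm :: "ereal \<Rightarrow> (nat \<Rightarrow> real) \<Rightarrow> real" where
  "lp_norm p x = (if p = \<infinity> then (SUP n. \<bar>x n\<bar>)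
                  else (\<Sum>n. \<bar>x n\<bar> powr real_of_ereal p) powr (1 / real_of_ereal p))"

definition lp_dist :: "ereal \<Rightarrow> (nat \<Rightarrow> real) \<Rightarrow> (nat \<Rightarrow> real) \<Rightarrow> real" where
  "lp_dist p x y = lp_norm p (\<lambda>n. x n - y n)"

end

theory Submission
  imports Defs "HOL-Real_Asymp.Real_Asymp"
begin

text \<open>Map the discrete torus \<open>\<int>\<^sub>m\<^sup>n\<close> into \<open>\<ell>\<^sub>p\<close> as a product of \<open>n\<close> circles of radius \<open>s\<close>, with \<open>s\<close> so
  large that the gauge separates all image points. Half-period shifts then move points by at
  least \<open>s\<close>, and shifts by a sign vector by at most a constant times \<open>s n\<^bsup>1/p\<^esup> / m\<close>. Sharp cotype on a space
  with two points forces \<open>m\<close> to be of order \<open>n\<^bsup>1/q\<^esup>\<close>, so for \<open>q < p\<close> the ratio of the two tends to \<open>0\<close>.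
  By the quasisymmetry that the cross ratio condition yields with the fourth point at
  infinity, the ratio of the image displacements tends to \<open>0\<close> as well, against the cotype inequality.\<close>

section \<open>Sequences of finite support in \<open>lp_space\<close>\<close>

lemma lp_norm_ge_coordinate:
  assumes "p \<ge> 1" and supp: "\<And>k. k \<ge> K \<Longrightarrow> v k = 0"
  shows "\<bar>v k\<bar> \<le> lp_norm p v"
proof (cases "p = \<infinity>")
  case True
  \<comment> \<open>Finite support leaves only finitely many values, so the supremum is taken over a
    bounded set and dominates each of them.\<close>
  have "range (\<lambda>k. \<bar>v k\<bar>) \<subseteq> insert 0 ((\<lambda>k. \<bar>v k\<bar>) ` {..<K})"
    using supp by (metis (no_types, lifting) abs_zero image_eqI image_subsetI insertCI lessThan_iff not_le)
  then have "bdd_above (range (\<lambda>k. \<bar>v k\<bar>))"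
    by (meson bdd_above_finite finite_imageI finite_insert finite_lessThan finite_subset)
  then show ?thesis using True by (simp add: lp_norm_def cSUP_upper2[of _ _ k])
next
  case False
  define r where "r = real_of_ereal p"
  have "r \<ge> 1" using assms(1) False unfolding r_def by (cases p) auto
  have "summable (\<lambda>k. \<bar>v k\<bar> powr r)"
    using supp by (intro summable_finite[of "{..<K}"]) auto
  then have "\<bar>v k\<bar> powr r \<le> (\<Sum>k. \<bar>v k\<bar> powr r)"
    using sum_le_suminf[of "\<lambda>k. \<bar>v k\<bar> powr r" "{k}"] by auto
  then have "(\<bar>v k\<bar> powr r) powr (1 / r) \<le> (\<Sum>k. \<bar>v k\<bar> powr r) powr (1 / r)"
    using \<open>r \<ge> 1\<close> by (intro powr_mono2) auto
  then show ?thesis using False \<open>r \<ge> 1\<close> by (simp add: lp_norm_def powr_powr r_def)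
qed

text \<open>For \<open>p = \<infinity>\<close> the exponent \<open>1 / real_of_ereal p\<close> is \<open>1 / 0 = 0\<close>, as it should be.\<close>

lemma lp_norm_le_coordinates:
  assumes "p \<ge> 1" and supp: "\<And>k. k \<ge> K \<Longrightarrow> v k = 0" and "K > 0"
    and le: "\<And>k. \<bar>v k\<bar> \<le> c"
  shows "lp_norm p v \<le> c * real K powr (1 / real_of_ereal p)"
proof (cases "p = \<infinity>")
  case True
  then show ?thesis using \<open>K > 0\<close> le by (auto simp: lp_norm_def intro!: cSUP_least)
next
  case False
  define r where "r = real_of_ereal p"
  have "r \<ge> 1" using assms(1) False unfolding r_def by (cases p) auto
  have "c \<ge> 0" using le[of 0] by linarith
  have "(\<Sum>k. \<bar>v k\<bar> powr r) = (\<Sum>k<K. \<bar>v k\<bar> powr r)"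
    using supp by (intro suminf_finite) auto
  also have "\<dots> \<le> (\<Sum>k<K. c powr r)"
    using le \<open>r \<ge> 1\<close> by (intro sum_mono powr_mono2) auto
  finally have "(\<Sum>k. \<bar>v k\<bar> powr r) \<le> c powr r * real K" by (simp add: mult.commute)
  moreover have "0 \<le> (\<Sum>k. \<bar>v k\<bar> powr r)"
    using supp by (intro suminf_nonneg summable_finite[of "{..<K}"]) auto
  ultimately have "(\<Sum>k. \<bar>v k\<bar> powr r) powr (1 / r) \<le> (c powr r * real K) powr (1 / r)"
    using \<open>r \<ge> 1\<close> by (intro powr_mono2) auto
  also have "\<dots> = c * real K powr (1 / r)"
    using \<open>c \<ge> 0\<close> \<open>r \<ge> 1\<close> by (simp add: powr_mult powr_powr)
  finally show ?thesis using False by (simp add: lp_norm_def r_def)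
qed

lemma lp_space_add_finite_support:
  assumes "a \<in> lp_space p" and supp: "\<And>k. k \<ge> K \<Longrightarrow> v k = 0"
  shows "(\<lambda>k. a k + v k) \<in> lp_space p"
proof (cases "p = \<infinity>")
  case True
  have "range v \<subseteq> insert 0 (v ` {..<K})"
    using supp by (metis image_eqI image_subsetI insertCI lessThan_iff not_le)
  then have "bounded (range v)"
    by (meson bounded_subset finite_imp_bounded finite_imageI finite_insert finite_lessThan)
  then show ?thesis
    using True assms(1) by (auto simp: lp_space_def intro: bounded_plus_comp)
next
  case False
  \<comment> \<open>Summability depends only on the tail, where both sequences agree.\<close>
  have "eventually (\<lambda>k. \<bar>a k + v k\<bar> powr real_of_ereal p = \<bar>a k\<bar> powr real_of_ereal p) sequentially"
    using supp by (intro eventually_sequentiallyI[of K]) auto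
  then show ?thesis
    using False assms(1) summable_cong by (fastforce simp: lp_space_def)
qed

section \<open>Gauges and weak quasisymmetry\<close>

text \<open>Scaling a configuration by \<open>s\<close> multiplies its moduli and its distances by
  \<open>s\<close>, while a gauge grows sublinearly. Here \<open>s * R\<close> stands for a sum of
  moduli and \<open>s * c\<close> for a distance, and the Limsup condition is used with the bound
  \<open>c / R\<close>.\<close>

lemma gauge_eventually_less:
  assumes "admissible_gauge u" "R > 0" "c > 0"
  shows "eventually (\<lambda>s. u (s * R) < s * c) at_top"
proof -
  have "Limsup at_top (\<lambda>r. ereal (u r / r)) < ereal (c / R)"
    using assms by (simp add: admissible_gauge_def)
  then have "eventually (\<lambda>r. u r / r < c / R) at_top"
    using Limsup_lessD by fastforce
  moreover have "filterlim (\<lambda>s. s * R) at_top at_top"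
    using \<open>R > 0\<close> by real_asymp
  ultimately have "eventually (\<lambda>s. u (s * R) / (s * R) < c / R) at_top"
    by (rule eventually_compose_filterlim)
  with eventually_gt_at_top[of 0] show ?thesis
    by eventually_elim (use \<open>R > 0\<close> in \<open>simp add: field_simps\<close>)
qed

text \<open>If the value at 0 were positive, the connected set of positive reals would be mapped
  both to 0 and to something above that value. It would then attain the value again, against
  injectivity.\<close>

lemma homeomorphism_half_line_0:
  fixes \<eta> :: "real \<Rightarrow> real"
  assumes "homeomorphism {0..} {0..} \<eta> \<eta>'"
  shows "\<eta> 0 = 0"
proof (rule ccontr)
  assume "\<eta> 0 \<noteq> 0"
  have cont: "continuous_on {0..} \<eta>" and im: "\<eta> ` {0..} = {0..}" and inj: "inj_on \<eta> {0..}"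
    using assms inj_on_inverseI[of "{0..}" \<eta>' \<eta>] by (auto simp: homeomorphism_def)
  have "\<eta> 0 > 0" using im \<open>\<eta> 0 \<noteq> 0\<close> by (metis atLeast_iff image_eqI less_le order_refl)
  have "\<eta> 0 + 1 \<in> \<eta> ` {0..}" "0 \<in> \<eta> ` {0..}" using im \<open>\<eta> 0 > 0\<close> by auto
  then have "\<eta> 0 + 1 \<in> \<eta> ` {0<..}" "0 \<in> \<eta> ` {0<..}"
    using \<open>\<eta> 0 \<noteq> 0\<close> by (force simp: image_iff less_le)+
  moreover have "connected (\<eta> ` {0<..})"
    by (intro connected_continuous_image continuous_on_subset[OF cont]) auto
  ultimately have "\<eta> 0 \<in> \<eta> ` {0<..}"
    using \<open>\<eta> 0 > 0\<close> by (auto simp: connected_iff_interval)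
  then show False using inj by (auto dest: inj_onD)
qed

text \<open>Putting the fourth point of the cross ratio at infinity turns the condition into weak
  quasisymmetry on sets of mutually separated points.\<close>

lemma AM_map_quasisymmetric:
  assumes "AM_map M d a N e b f" and "Metric_space N e"
  obtains u \<eta> where "admissible_gauge u" "continuous_on {0..} \<eta>" "\<eta> 0 = 0"
    "\<And>S x y z. \<lbrakk>S \<subseteq> M; \<And>x y. \<lbrakk>x \<in> S; y \<in> S; x \<noteq> y\<rbrakk> \<Longrightarrow> u (d a x + d a y) < d x y;
        x \<in> S; y \<in> S; z \<in> S; x \<noteq> y; y \<noteq> z; x \<noteq> z\<rbrakk> \<Longrightarrow>
      the (f (Some x)) \<in> N \<and> the (f (Some y)) \<noteq> the (f (Some z)) \<and>
      e (the (f (Some x))) (the (f (Some z)))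
        \<le> \<eta> (d x z / d y z) * e (the (f (Some y))) (the (f (Some z)))"
proof -
  interpret N: Metric_space N e by fact
  obtain u \<eta> \<eta>' where u: "admissible_gauge u" and \<eta>: "homeomorphism {0..} {0..} \<eta> \<eta>'"
    and AM: "\<And>x y z w. \<lbrakk>x \<in> with_infinity M; y \<in> with_infinity M; z \<in> with_infinity M;
        w \<in> with_infinity M; pairwise_separated4 d a u x y z w\<rbrakk> \<Longrightarrow>
        cross_ratio_defined x y z w \<and> cross_ratio_defined (f x) (f y) (f z) (f w) \<and>
        cross_ratio e (f x) (f y) (f z) (f w) < \<eta> (cross_ratio d x y z w)"
    and f: "f ` with_infinity M \<subseteq> with_infinity N" "f None = None"
    using assms(1) unfolding AM_map_def pointed_map_def by metis
  show thesis
  proof (rule that)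
    show "admissible_gauge u" by fact
    show "continuous_on {0..} \<eta>" using \<eta> by (simp add: homeomorphism_def)
    show "\<eta> 0 = 0" using \<eta> by (rule homeomorphism_half_line_0)
    fix S x y z
    assume S: "S \<subseteq> M" and sep: "\<And>x y. \<lbrakk>x \<in> S; y \<in> S; x \<noteq> y\<rbrakk> \<Longrightarrow> u (d a x + d a y) < d x y"
      and xyz: "x \<in> S" "y \<in> S" "z \<in> S" "x \<noteq> y" "y \<noteq> z" "x \<noteq> z"
    have triple: "f (Some x) \<noteq> None \<and> f (Some y) \<noteq> f (Some z) \<and>
        cross_ratio e (f (Some x)) (f (Some y)) (f (Some z)) None < \<eta> (d x z / d y z)"
      if "x \<in> S" "y \<in> S" "z \<in> S" "x \<noteq> y" "y \<noteq> z" "x \<noteq> z" for x y z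
    proof -
      have "pairwise_separated4 d a u (Some x) (Some y) (Some z) None"
        using that sep by (simp add: pairwise_separated4_def)
      moreover have "cross_ratio d (Some x) (Some y) (Some z) None = d x z / d y z"
        using that by (simp add: cross_ratio_def)
      moreover have "Some x \<in> with_infinity M" "Some y \<in> with_infinity M"
          "Some z \<in> with_infinity M" "None \<in> with_infinity M"
        using that S by (auto simp: with_infinity_def)
      ultimately show ?thesis
        using AM[of "Some x" "Some y" "Some z" None] f(2) by (simp add: cross_ratio_defined_def)
    qed
    \<comment> \<open>Definedness of a cross ratio whose last entry is infinite says that its first
      entry has a finite image. Each of the three points is therefore put first once.\<close>
    have "f (Some x) \<noteq> None" "f (Some y) \<noteq> None" "f (Some z) \<noteq> None"
      using triple[of x y z] triple[of y x z] triple[of z x y] xyz by auto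
    moreover have "Some x \<in> with_infinity M" "Some y \<in> with_infinity M" "Some z \<in> with_infinity M"
      using xyz S by (auto simp: with_infinity_def)
    ultimately obtain x' y' z' where im: "f (Some x) = Some x'" "f (Some y) = Some y'" "f (Some z) = Some z'"
      and N: "x' \<in> N" "y' \<in> N" "z' \<in> N"
      using f(1) by (fastforce simp: with_infinity_def image_subset_iff)
    have "y' \<noteq> z'" using triple[of x y z] xyz im by auto
    then have pos: "e y' z' > 0" using N by simp
    \<comment> \<open>The images \<open>x'\<close> and \<open>z'\<close> may coincide; then the
      conventional value 0 agrees with the quotient.\<close>
    have "cross_ratio e (Some x') (Some y') (Some z') None = e x' z' / e y' z'"
      using N by (simp add: cross_ratio_def)
    then have "e x' z' / e y' z' < \<eta> (d x z / d y z)"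
      using triple[of x y z] xyz im by simp
    then have "e x' z' \<le> \<eta> (d x z / d y z) * e y' z'"
      using pos by (simp add: field_simps)
    then show "the (f (Some x)) \<in> N \<and> the (f (Some y)) \<noteq> the (f (Some z)) \<and>
      e (the (f (Some x))) (the (f (Some z)))
        \<le> \<eta> (d x z / d y z) * e (the (f (Some y))) (the (f (Some z)))"
      using im N \<open>y' \<noteq> z'\<close> by simp
  qed
qed

section \<open>Averages over the torus and two consequences of the cotype inequality\<close>

lemma finite_torus: "finite (torus n m)"
  by (auto simp: torus_def intro: finite_PiE)

lemma torus_nonempty: "m > 0 \<Longrightarrow> torus n m \<noteq> {}"
  by (auto simp: torus_def PiE_eq_empty_iff)

lemma finite_sign_vectors: "finite (sign_vectors n)"
  by (auto simp: sign_vectors_def intro: finite_PiE)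

lemma sign_vectors_nonempty: "sign_vectors n \<noteq> {}"
  by (auto simp: sign_vectors_def PiE_eq_empty_iff)

lemma torus_add_in_torus: "m > 0 \<Longrightarrow> torus_add n m x v \<in> torus n m"
  by (auto simp: torus_def torus_add_def)

lemma average_mono:
  "(\<And>s. s \<in> S \<Longrightarrow> g s \<le> g' s) \<Longrightarrow> average S g \<le> average S g'"
  unfolding average_def by (intro divide_right_mono sum_mono) auto

lemma average_const:
  "finite S \<Longrightarrow> S \<noteq> {} \<Longrightarrow> average S (\<lambda>_. c) = c"
  by (simp add: average_def)

lemma average_cmult: "average S (\<lambda>s. c * g s) = c * average S g"
  by (simp add: average_def sum_distrib_left)

lemma average_snd:
  assumes "finite S" "S \<noteq> {}"
  shows "average (S \<times> T) (\<lambda>(s, t). g t) = average T g"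
proof -
  have "(\<Sum>(s, t)\<in>S \<times> T. g t) = real (card S) * sum g T"
    by (simp flip: sum.cartesian_product)
  then show ?thesis using assms by (simp add: average_def card_cartesian_product)
qed

text \<open>This is the half-period shift in direction \<open>j\<close>, spelled exactly as in
  \<open>metric_cotype_ineq\<close>. On the product of circles it sends the \<open>j\<close>-th
  component to its antipodal point.\<close>

abbreviation antipode :: "nat \<Rightarrow> nat \<Rightarrow> nat \<Rightarrow> (nat \<Rightarrow> int) \<Rightarrow> (nat \<Rightarrow> int)" where
  "antipode n m j x \<equiv> torus_add n m x (\<lambda>i. if i = j then int (m div 2) else 0)"

text \<open>The quotient by \<open>t\<close> is 0 on the first half of a cycle of length
  \<open>2 * t\<close> and 1 on the second; adding \<open>t\<close> swaps the halves.\<close>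

lemma half_shift_parity:
  fixes k t :: int
  assumes "t > 0" "0 \<le> k" "k < 2 * t"
  shows "even ((k + t) mod (2 * t) div t) \<longleftrightarrow> odd (k div t)"
proof (cases "k < t")
  case True
  then have "(k + t) mod (2 * t) = k + t" using assms by simp
  then show ?thesis using True assms by simp
next
  case False
  have "(k + t) mod (2 * t) = (k - t + 2 * t) mod (2 * t)" by (simp add: add.commute)
  also have "\<dots> = (k - t) mod (2 * t)" by (rule mod_add_self2)
  also have "\<dots> = k - t" using False assms by simp
  finally have 1: "(k + t) mod (2 * t) div t = 0" using False assms by simp
  have "k div t = (k - t + t) div t" by simp
  also have "\<dots> = (k - t) div t + 1" using assms by (intro div_add_self2) simp
  also have "\<dots> = 1" using False assms by simp
  finally show ?thesis using 1 by simp
qed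

text \<open>The cotype inequality is tested on the two-valued function that changes its value under
  every half-period shift.\<close>

lemma metric_cotype_ineq_lower_bound:
  assumes "Metric_space M d" "metric_cotype_ineq M d q C n m" "even m" "m > 0" "C > 0" "q > 0"
    and xy: "x0 \<in> M" "y0 \<in> M" "x0 \<noteq> y0"
  shows "real n \<le> (C * real m) powr q"
proof -
  interpret Metric_space M d by fact
  define t where "t = int (m div 2)"
  have m: "int m = 2 * t" and "t > 0" using \<open>even m\<close> \<open>m > 0\<close> by (auto simp: t_def)
  \<comment> \<open>Each summand is 0 or 1, so \<open>s x\<close> counts the coordinates in the
    second half of the cycle. A half-period shift changes exactly one summand, hence the
    parity.\<close>
  define s where "s x = (\<Sum>i<n. x i div t)" for x :: "nat \<Rightarrow> int"
  define h where "h x = (if even (s x) then x0 else y0)" for x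
  have flip: "even (s (antipode n m j x)) \<longleftrightarrow> odd (s x)" if "x \<in> torus n m" "j < n" for x j
  proof -
    have x: "0 \<le> x i" "x i < 2 * t" if "i < n" for i
      using \<open>x \<in> torus n m\<close> that m by (auto simp: torus_def PiE_iff)
    have "s (antipode n m j x) = (x j + t) mod (2 * t) div t + (\<Sum>i\<in>{..<n} - {j}. x i div t)"
      unfolding s_def using that x m
      by (subst sum.remove[of _ j]) (auto simp: torus_add_def t_def[symmetric] intro!: sum.cong)
    moreover have "s x = x j div t + (\<Sum>i\<in>{..<n} - {j}. x i div t)"
      unfolding s_def using that by (subst sum.remove[of _ j]) auto
    ultimately show ?thesis using half_shift_parity[of t "x j"] x[OF \<open>j < n\<close>] \<open>t > 0\<close> by auto
  qed
  define D where "D = d x0 y0 powr q"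
  have "D > 0" using xy by (simp add: D_def)
  \<comment> \<open>All terms on the left of the cotype inequality equal \<open>D\<close>, those on
    the right are at most \<open>D\<close>, and \<open>D\<close> cancels.\<close>
  have "real n * D = (\<Sum>j<n. average (torus n m) (\<lambda>_. D))"
    using \<open>m > 0\<close> by (simp add: average_const finite_torus torus_nonempty)
  also have "\<dots> \<le> (\<Sum>j<n. average (torus n m) (\<lambda>x. d (h (antipode n m j x)) (h x) powr q))"
    by (intro sum_mono average_mono) (use flip in \<open>auto simp: h_def D_def commute\<close>)
  also have "\<dots> \<le> C powr q * real m powr q *
      average (sign_vectors n \<times> torus n m) (\<lambda>(\<epsilon>, x). d (h (torus_add n m x \<epsilon>)) (h x) powr q)"
    using assms(2) xy unfolding metric_cotype_ineq_def by (force simp: h_def)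
  also have "\<dots> \<le> C powr q * real m powr q * average (sign_vectors n \<times> torus n m) (\<lambda>_. D)"
    by (intro mult_left_mono average_mono) (use xy in \<open>auto simp: h_def D_def commute\<close>)
  also have "\<dots> = (C * real m) powr q * D"
    using \<open>m > 0\<close> \<open>C > 0\<close>
    by (simp add: average_const finite_torus torus_nonempty finite_sign_vectors
        sign_vectors_nonempty powr_mult)
  finally show ?thesis using \<open>D > 0\<close> by simp
qed

text \<open>Let \<open>E\<close> be the average over sign shifts and \<open>L j\<close> the average
  over half-period shifts in direction \<open>j\<close>. The bound \<open>small\<close> gives E
  \<le> \<delta>^q L_j for every j. Summing over j and inserting the cotype inequality bounds n E by
  (\<delta> C m)^q E, and E cancels.\<close>

lemma metric_cotype_ineq_contraction:
  assumes "Metric_space M d" "metric_cotype_ineq M d q C n m" "m > 0" "n > 0" "C > 0" "q > 0" "\<delta> > 0"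
    and h: "h \<in> torus n m \<rightarrow> M"
    and pos: "\<And>x j. \<lbrakk>x \<in> torus n m; j < n\<rbrakk> \<Longrightarrow> h (antipode n m j x) \<noteq> h x"
    and small: "\<And>x j \<epsilon>. \<lbrakk>x \<in> torus n m; j < n; \<epsilon> \<in> sign_vectors n\<rbrakk> \<Longrightarrow>
      d (h (torus_add n m x \<epsilon>)) (h x) \<le> \<delta> * d (h (antipode n m j x)) (h x)"
  shows "real n \<le> (\<delta> * C * real m) powr q"
proof -
  interpret Metric_space M d by fact
  let ?S = "sign_vectors n" and ?T = "torus n m"
  define E where "E = average (?S \<times> ?T) (\<lambda>(\<epsilon>, x). d (h (torus_add n m x \<epsilon>)) (h x) powr q)"
  define L where "L j = average ?T (\<lambda>x. d (h (antipode n m j x)) (h x) powr q)" for j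
  have cotype: "(\<Sum>j<n. L j) \<le> C powr q * real m powr q * E"
    using assms(2) h unfolding metric_cotype_ineq_def L_def E_def by blast
  have "L j > 0" if "j < n" for j
  proof -
    have "0 < (\<Sum>x\<in>?T. d (h (antipode n m j x)) (h x) powr q)"
    proof (intro sum_pos)
      fix x assume x: "x \<in> ?T"
      then have "h (antipode n m j x) \<in> M" "h x \<in> M"
        using h \<open>m > 0\<close> torus_add_in_torus by blast+
      then show "0 < d (h (antipode n m j x)) (h x) powr q"
        using pos[OF x that] by simp
    qed (use \<open>m > 0\<close> in \<open>auto simp: finite_torus torus_nonempty\<close>)
    then show ?thesis
      using \<open>m > 0\<close> by (simp add: L_def average_def finite_torus torus_nonempty card_gt_0_iff)
  qed
  then have "0 < (\<Sum>j<n. L j)" using \<open>n > 0\<close> by (intro sum_pos) auto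
  \<comment> \<open>Were \<open>E\<close> not positive, the right side of the cotype inequality
    would not be either, although its left side is.\<close>
  with cotype have "E > 0" by (smt (verit) mult_nonneg_nonpos powr_ge_zero zero_le_mult_iff)
  have "E \<le> \<delta> powr q * L j" if "j < n" for j
  proof -
    have "E \<le> average (?S \<times> ?T) (\<lambda>(\<epsilon>, x). \<delta> powr q * d (h (antipode n m j x)) (h x) powr q)"
      unfolding E_def
    proof (intro average_mono, clarify)
      fix \<epsilon> x assume "\<epsilon> \<in> ?S" "x \<in> ?T"
      then have "d (h (torus_add n m x \<epsilon>)) (h x) powr q
          \<le> (\<delta> * d (h (antipode n m j x)) (h x)) powr q"
        using small that \<open>q > 0\<close> by (intro powr_mono2) auto
      then show "d (h (torus_add n m x \<epsilon>)) (h x) powr q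
          \<le> \<delta> powr q * d (h (antipode n m j x)) (h x) powr q"
        using \<open>\<delta> > 0\<close> by (simp add: powr_mult)
    qed
    then show ?thesis
      by (simp add: average_snd finite_sign_vectors sign_vectors_nonempty average_cmult L_def)
  qed
  then have "(\<Sum>j<n. E) \<le> (\<Sum>j<n. \<delta> powr q * L j)" by (intro sum_mono) auto
  then have "real n * E \<le> \<delta> powr q * (\<Sum>j<n. L j)" by (simp add: sum_distrib_left)
  also have "\<dots> \<le> \<delta> powr q * (C powr q * real m powr q * E)"
    by (intro mult_left_mono cotype) auto
  finally have "real n * E \<le> (\<delta> * C * real m) powr q * E"
    using \<open>\<delta> > 0\<close> \<open>C > 0\<close> by (simp add: powr_mult mult_ac)
  then show ?thesis using \<open>E > 0\<close> by simp
qed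

section \<open>The discrete torus as a product of circles\<close>

text \<open>Coordinates 2i and 2i+1 hold the real and imaginary part of exp(2 \<pi> \<i> x_i / m),
  so n unit circles are laid out in one real sequence of finite support.\<close>

definition circles :: "nat \<Rightarrow> nat \<Rightarrow> (nat \<Rightarrow> int) \<Rightarrow> nat \<Rightarrow> real" where
  "circles n m x k =
     (if k < 2 * n then (if even k then cos else sin) (2 * pi * of_int (x (k div 2)) / real m) else 0)"

lemma abs_circles_le_1: "\<bar>circles n m x k\<bar> \<le> 1"
  by (simp add: circles_def)

lemma circles_eq_0: "k \<ge> 2 * n \<Longrightarrow> circles n m x k = 0"
  by (simp add: circles_def)

text \<open>Reduction modulo \<open>m\<close> changes an angle by a multiple of 2 \<pi>, so it may
  be dropped.\<close>

lemma circles_torus_add: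
  assumes "m > 0"
  shows "circles n m (torus_add n m x v) k = circles n m (\<lambda>i. x i + v i) k"
proof -
  have shift: "2 * pi * of_int z / real m =
      2 * pi * of_int (z mod int m) / real m + of_int (z div int m) * (2 * pi)" for z
  proof -
    have "real_of_int z = of_int (z mod int m) + of_int (z div int m) * real m"
      by (metis mod_mult_div_eq add.commute of_int_add of_int_mult of_int_of_nat_eq mult.commute)
    then show ?thesis using assms by (simp add: field_simps)
  qed
  have "cos (2 * pi * of_int (z mod int m) / real m) = cos (2 * pi * of_int z / real m)"
    "sin (2 * pi * of_int (z mod int m) / real m) = sin (2 * pi * of_int z / real m)" for z
    using cos.plus_of_int[of "2 * pi * of_int (z mod int m) / real m" "z div int m"]
      sin.plus_of_int[of "2 * pi * of_int (z mod int m) / real m" "z div int m"]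
    unfolding shift[of z] by (simp_all only: of_real_eq_id id_apply)
  then show ?thesis by (auto simp: circles_def torus_add_def)
qed

lemma abs_cos_diff_le: "\<bar>cos a - cos b\<bar> \<le> \<bar>a - b\<bar>" for a b :: real
proof -
  have "\<bar>cos a - cos b\<bar> = 2 * \<bar>sin ((a + b) / 2)\<bar> * \<bar>sin ((b - a) / 2)\<bar>"
    by (simp add: cos_diff_cos abs_mult)
  also have "\<dots> \<le> 2 * 1 * \<bar>(b - a) / 2\<bar>"
    by (intro mult_mono abs_sin_x_le_abs_x) auto
  finally show ?thesis by simp
qed

lemma abs_sin_diff_le: "\<bar>sin a - sin b\<bar> \<le> \<bar>a - b\<bar>" for a b :: real
  using abs_cos_diff_le[of "pi / 2 - a" "pi / 2 - b"] by (simp add: cos_diff)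

text \<open>Each angle moves by at most 2 \<pi> / m, and cosine and sine are 1-Lipschitz.\<close>

lemma circles_step:
  assumes "m > 0" "\<epsilon> \<in> sign_vectors n"
  shows "\<bar>circles n m (torus_add n m x \<epsilon>) k - circles n m x k\<bar> \<le> 2 * pi / real m"
proof (cases "k < 2 * n")
  case True
  define \<alpha> \<beta> where "\<alpha> = 2 * pi * of_int (x (k div 2) + \<epsilon> (k div 2)) / real m"
    and "\<beta> = 2 * pi * of_int (x (k div 2)) / real m"
  have "\<epsilon> (k div 2) \<in> {-1, 0, 1}"
    using assms(2) True by (auto simp: sign_vectors_def PiE_iff)
  moreover have "\<alpha> - \<beta> = 2 * pi * of_int (\<epsilon> (k div 2)) / real m"
    by (simp add: \<alpha>_def \<beta>_def distrib_left add_divide_distrib)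
  ultimately have "\<bar>\<alpha> - \<beta>\<bar> \<le> 2 * pi / real m" by (auto simp: abs_mult)
  then show ?thesis
    using True abs_cos_diff_le[of \<alpha> \<beta>] abs_sin_diff_le[of \<alpha> \<beta>]
    unfolding circles_torus_add[OF \<open>m > 0\<close>] by (auto simp: circles_def \<alpha>_def \<beta>_def)
qed (simp add: circles_eq_0)

text \<open>Adding \<pi> to an angle \<beta> negates both of its coordinates, which moves them by 2
  |cos \<beta>| and 2 |sin \<beta>|. These cannot both be below 1, as the squares of sine and cosine
  add up to 1.\<close>

lemma circles_antipode:
  assumes "m > 0" "even m" "j < n"
  shows "\<exists>k. \<bar>circles n m (antipode n m j x) k - circles n m x k\<bar> \<ge> 1"
proof -
  define \<beta> where "\<beta> = 2 * pi * of_int (x j) / real m"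
  have "2 * pi * of_int (x j + int (m div 2)) / real m = \<beta> + pi"
    using assms by (auto simp: \<beta>_def field_simps elim!: evenE)
  then have "circles n m (antipode n m j x) (2 * j) - circles n m x (2 * j) = - 2 * cos \<beta>"
    "circles n m (antipode n m j x) (2 * j + 1) - circles n m x (2 * j + 1) = - 2 * sin \<beta>"
    unfolding circles_torus_add[OF \<open>m > 0\<close>] using \<open>j < n\<close>
    by (simp_all add: circles_def \<beta>_def)
  moreover have "1 \<le> 2 * \<bar>cos \<beta>\<bar> \<or> 1 \<le> 2 * \<bar>sin \<beta>\<bar>"
  proof (rule ccontr)
    assume "\<not> ?thesis"
    then have "\<bar>cos \<beta>\<bar>\<^sup>2 \<le> (1/2)\<^sup>2" "\<bar>sin \<beta>\<bar>\<^sup>2 \<le> (1/2)\<^sup>2"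
      by (intro power_mono; simp)+
    then show False using sin_cos_squared_add[of \<beta>] by (simp add: power2_eq_square)
  qed
  ultimately show ?thesis by (metis abs_mult abs_minus_cancel abs_numeral mult_minus_left)
qed

text \<open>Cosine and sine together determine an angle modulo 2 \<pi>, hence each torus coordinate
  modulo \<open>m\<close>, and the representatives in \<open>{0..<int m}\<close> are unique.\<close>

lemma circles_inj:
  assumes "m > 0" "x \<in> torus n m" "y \<in> torus n m" "x \<noteq> y"
  shows "\<exists>k. circles n m x k \<noteq> circles n m y k"
proof (rule ccontr)
  assume *: "\<not> ?thesis"
  obtain i where "i < n" "x i \<noteq> y i"
    using assms PiE_ext unfolding torus_def by (metis lessThan_iff)
  have "cos (2 * pi * of_int (x i) / real m) = cos (2 * pi * of_int (y i) / real m)"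
    "sin (2 * pi * of_int (x i) / real m) = sin (2 * pi * of_int (y i) / real m)"
    using *[simplified, rule_format, of "2 * i"] *[simplified, rule_format, of "2 * i + 1"] \<open>i < n\<close>
    by (simp_all add: circles_def)
  then obtain l :: int where "2 * pi * of_int (x i) / real m = 2 * pi * of_int (y i) / real m + 2 * pi * of_int l"
    using sin_cos_eq_iff by blast
  then have "pi * of_int (x i) = pi * (of_int (y i) + real m * of_int l)"
    using \<open>m > 0\<close> by (simp add: field_simps)
  then have "real_of_int (x i) = of_int (y i + int m * l)" by simp
  then have "x i = y i + int m * l" by (simp only: of_int_eq_iff)
  then have "x i mod int m = y i mod int m" by simp
  moreover have "0 \<le> x i" "x i < int m" "0 \<le> y i" "y i < int m"
    using assms \<open>i < n\<close> by (auto simp: torus_def PiE_iff)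
  ultimately show False using \<open>x i \<noteq> y i\<close> by simp
qed

section \<open>Scaled products of circles in \<open>lp_space\<close>\<close>

text \<open>Centring at the origin \<open>a\<close> makes the moduli, like the mutual distances,
  proportional to the radius \<open>s\<close>.\<close>

definition lp_circles :: "(nat \<Rightarrow> real) \<Rightarrow> real \<Rightarrow> nat \<Rightarrow> nat \<Rightarrow> (nat \<Rightarrow> int) \<Rightarrow> nat \<Rightarrow> real" where
  "lp_circles a s n m x k = a k + s * circles n m x k"

lemma lp_circles_in_lp_space: "a \<in> lp_space p \<Longrightarrow> lp_circles a s n m x \<in> lp_space p"
  unfolding lp_circles_def[abs_def]
  by (rule lp_space_add_finite_support[of _ _ "2 * n"]) (auto simp: circles_eq_0)

lemma lp_dist_circles_ge:
  assumes "p \<ge> 1" "s \<ge> 0"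
  shows "s * \<bar>circles n m x k - circles n m y k\<bar> \<le> lp_dist p (lp_circles a s n m x) (lp_circles a s n m y)"
  using lp_norm_ge_coordinate[OF \<open>p \<ge> 1\<close>, of "2 * n"
      "\<lambda>k. lp_circles a s n m x k - lp_circles a s n m y k" k] \<open>s \<ge> 0\<close>
  by (simp add: lp_dist_def lp_circles_def circles_eq_0 abs_mult flip: right_diff_distrib)

lemma lp_dist_circles_le:
  assumes "p \<ge> 1" "s \<ge> 0" "n > 0"
    and "\<And>k. \<bar>circles n m x k - circles n m y k\<bar> \<le> c"
  shows "lp_dist p (lp_circles a s n m x) (lp_circles a s n m y)
    \<le> s * c * real (2 * n) powr (1 / real_of_ereal p)"
  unfolding lp_dist_def
  using assms by (intro lp_norm_le_coordinates)
    (auto simp: lp_circles_def circles_eq_0 abs_mult mult_left_mono simp flip: right_diff_distrib)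

lemma lp_dist_origin_circles:
  assumes "p \<ge> 1" "s \<ge> 0" "n > 0"
  shows "0 \<le> lp_dist p a (lp_circles a s n m x)"
    and "lp_dist p a (lp_circles a s n m x) \<le> s * real (2 * n) powr (1 / real_of_ereal p)"
proof -
  have "\<bar>a 0 - lp_circles a s n m x 0\<bar> \<le> lp_dist p a (lp_circles a s n m x)"
    unfolding lp_dist_def using \<open>p \<ge> 1\<close>
    by (intro lp_norm_ge_coordinate[of _ "2 * n"]) (auto simp: lp_circles_def circles_eq_0)
  then show "0 \<le> lp_dist p a (lp_circles a s n m x)" by linarith
  show "lp_dist p a (lp_circles a s n m x) \<le> s * real (2 * n) powr (1 / real_of_ereal p)"
    unfolding lp_dist_def using assms
    by (intro lp_norm_le_coordinates)
      (auto simp: lp_circles_def circles_eq_0 abs_mult abs_circles_le_1 mult_left_le)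
qed

text \<open>For a fixed pair of distinct torus points the distance is at least \<open>s * c\<close>
  with \<open>c > 0\<close> independent of \<open>s\<close>, so a large radius separates the pair.
  There are only finitely many pairs, so one radius serves all of them.\<close>

lemma lp_circles_separated:
  assumes "admissible_gauge u" "p \<ge> 1" "n > 0" "m > 0"
  obtains s where "s > 0"
    "\<And>x y. \<lbrakk>x \<in> torus n m; y \<in> torus n m; x \<noteq> y\<rbrakk> \<Longrightarrow>
      u (lp_dist p a (lp_circles a s n m x) + lp_dist p a (lp_circles a s n m y))
        < lp_dist p (lp_circles a s n m x) (lp_circles a s n m y)"
proof -
  \<comment> \<open>Twice the bound on one modulus at radius 1, hence a bound on the sum of two
    moduli.\<close>
  define R where "R = 2 * real (2 * n) powr (1 / real_of_ereal p)"
  have "R > 0" using \<open>n > 0\<close> by (simp add: R_def)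
  have "eventually (\<lambda>s. x \<noteq> y \<longrightarrow>
      u (lp_dist p a (lp_circles a s n m x) + lp_dist p a (lp_circles a s n m y))
        < lp_dist p (lp_circles a s n m x) (lp_circles a s n m y)) at_top"
    if xy: "x \<in> torus n m" "y \<in> torus n m" for x y
  proof (cases "x = y")
    case False
    then obtain k where k: "circles n m x k \<noteq> circles n m y k"
      using circles_inj[OF \<open>m > 0\<close> xy] by blast
    define c where "c = \<bar>circles n m x k - circles n m y k\<bar>"
    have "c > 0" using k by (simp add: c_def)
    from gauge_eventually_less[OF assms(1) \<open>R > 0\<close> this] eventually_gt_at_top[of 0] show ?thesis
    proof eventually_elim
      case (elim s)
      define X where "X = lp_dist p a (lp_circles a s n m x) + lp_dist p a (lp_circles a s n m y)"
      have "0 \<le> X" "X \<le> s * R"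
        using lp_dist_origin_circles[OF \<open>p \<ge> 1\<close> _ \<open>n > 0\<close>, of s a m x]
          lp_dist_origin_circles[OF \<open>p \<ge> 1\<close> _ \<open>n > 0\<close>, of s a m y] elim
        by (simp_all add: X_def R_def)
      then have "u X \<le> u (s * R)"
        using assms(1) unfolding admissible_gauge_def by (auto intro: mono_onD)
      also have "\<dots> < s * c" by (rule elim)
      also have "\<dots> \<le> lp_dist p (lp_circles a s n m x) (lp_circles a s n m y)"
        unfolding c_def using lp_dist_circles_ge[OF \<open>p \<ge> 1\<close>] elim by simp
      finally show ?case by (simp add: X_def)
    qed
  qed simp
  then have "eventually (\<lambda>s. \<forall>x\<in>torus n m. \<forall>y\<in>torus n m. x \<noteq> y \<longrightarrow>
      u (lp_dist p a (lp_circles a s n m x) + lp_dist p a (lp_circles a s n m y))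
        < lp_dist p (lp_circles a s n m x) (lp_circles a s n m y)) at_top"
    by (intro eventually_ball_finite finite_torus ballI)
  with eventually_gt_at_top[of 0] have "eventually (\<lambda>s. s > 0 \<and> (\<forall>x\<in>torus n m. \<forall>y\<in>torus n m. x \<noteq> y \<longrightarrow>
      u (lp_dist p a (lp_circles a s n m x) + lp_dist p a (lp_circles a s n m y))
        < lp_dist p (lp_circles a s n m x) (lp_circles a s n m y))) at_top"
    by (rule eventually_conj)
  from eventually_happens[OF this] show thesis using that by auto
qed

section \<open>Choice of parameters and the contradiction\<close>

theorem theorem1p3:
  fixes p q :: ereal
    and a :: "nat \<Rightarrow> real"
    and N :: "'b set" and e :: "'b \<Rightarrow> 'b \<Rightarrow> real" and b :: 'b
  assumes "2 \<le> p" and "2 \<le> q" and "q < p"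
    and "a \<in> lp_space p"
    and "Metric_space N e" and "\<not> Metric_space.mbounded N e N" and "b \<in> N"
    and "sharp_metric_cotype N e (real_of_ereal q)"
  shows "\<not> (\<exists>f. AM_map (lp_space p) (lp_dist p) a N e b f \<and>
                 regular_map (lp_space p) (lp_dist p) N e f)"
proof (rule notI, elim exE conjE, erule AM_map_quasisymmetric[OF _ \<open>Metric_space N e\<close>])
  fix f u \<eta>
  assume u: "admissible_gauge u" and \<eta>: "continuous_on {0..} \<eta>" "\<eta> 0 = 0"
    and quasi: "\<And>S x y z. \<lbrakk>S \<subseteq> lp_space p;
        \<And>x y. \<lbrakk>x \<in> S; y \<in> S; x \<noteq> y\<rbrakk> \<Longrightarrow> u (lp_dist p a x + lp_dist p a y) < lp_dist p x y;
        x \<in> S; y \<in> S; z \<in> S; x \<noteq> y; y \<noteq> z; x \<noteq> z\<rbrakk> \<Longrightarrow>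
      the (f (Some x)) \<in> N \<and> the (f (Some y)) \<noteq> the (f (Some z)) \<and>
      e (the (f (Some x))) (the (f (Some z)))
        \<le> \<eta> (lp_dist p x z / lp_dist p y z) * e (the (f (Some y))) (the (f (Some z)))"
  interpret N: Metric_space N e by fact
  \<comment> \<open>The exponent \<open>q\<close> is finite since it lies below \<open>p\<close>.
    For \<open>p = \<infinity>\<close> the default value of division gives \<open>P = 0\<close>, so
    \<open>P < 1 / Q\<close> covers that case too.\<close>
  define Q P where "Q = real_of_ereal q" and "P = 1 / real_of_ereal p"
  have "p \<ge> 1" using \<open>2 \<le> p\<close> by (cases p) auto
  have "Q > 0" "P < 1 / Q"
    using \<open>2 \<le> p\<close> \<open>2 \<le> q\<close> \<open>q < p\<close> unfolding Q_def P_def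
    by (cases p; cases q; force simp: frac_less2)+
  obtain x0 y0 C A where xy0: "x0 \<in> N" "y0 \<in> N" "x0 \<noteq> y0" and "C > 0"
    and cotype: "\<And>n. n \<ge> 1 \<Longrightarrow> \<exists>m>0. even m \<and> real m \<le> A * real n powr (1 / Q) \<and>
        metric_cotype_ineq N e Q C n m"
    using assms(8) unfolding sharp_metric_cotype_def Q_def by metis
  have "A > 0"
    using cotype[of 1] by fastforce
  \<comment> \<open>Chosen so that \<open>\<delta> * C * A\<close> is 1/2, which makes the
    contraction bound at the end strictly smaller than \<open>n\<close>.\<close>
  define \<delta> where "\<delta> = 1 / (2 * C * A)"
  have "\<delta> > 0" using \<open>C > 0\<close> \<open>A > 0\<close> by (simp add: \<delta>_def)
  obtain t where "t > 0" and t: "\<And>r. 0 \<le> r \<Longrightarrow> r < t \<Longrightarrow> \<eta> r < \<delta>"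
  proof -
    obtain t where "t > 0" "\<forall>r\<in>{0..}. dist r 0 < t \<longrightarrow> dist (\<eta> r) (\<eta> 0) < \<delta>"
      using \<eta>(1) \<open>\<delta> > 0\<close> unfolding continuous_on_iff by force
    then show thesis using that \<eta>(2) by (force simp: dist_real_def)
  qed
  \<comment> \<open>The expression bounds the ratio of a sign displacement, at most 2 \<pi> s (2n)^P
    / m, to an antipodal one, at least s, once 1/m \<le> C n^(-1/Q) is known. It tends to 0 because
    \<open>P < 1 / Q\<close>.\<close>
  have "eventually (\<lambda>n. 2 * pi * C * real (2 * n) powr P * real n powr (- 1 / Q) < t) sequentially"
  proof -
    have "(\<lambda>n. 2 * pi * C * 2 powr P * real n powr (P - 1 / Q)) \<longlonglongrightarrow> 2 * pi * C * 2 powr P * 0"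
      using \<open>P < 1 / Q\<close>
      by (intro tendsto_mult tendsto_const tendsto_neg_powr filterlim_real_sequentially) auto
    then have "eventually (\<lambda>n. 2 * pi * C * 2 powr P * real n powr (P - 1 / Q) < t) sequentially"
      using \<open>t > 0\<close> order_tendstoD(2) by fastforce
    then show ?thesis
      by eventually_elim (simp add: powr_mult powr_diff powr_minus field_simps)
  qed
  \<comment> \<open>Together with the lower bound on \<open>m\<close> this will force
    \<open>m > 7\<close>, hence 2 \<pi> / m < 1.\<close>
  moreover have "eventually (\<lambda>n. real n > (C * 7) powr Q) sequentially"
    by real_asymp
  ultimately obtain n where n: "2 * pi * C * real (2 * n) powr P * real n powr (- 1 / Q) < t"
    "real n > (C * 7) powr Q"
    using eventually_happens[OF eventually_conj] by (metis (no_types, lifting) sequentially_bot)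
  have "n > 0" using n(2) by (smt (verit) of_nat_0_less_iff powr_ge_zero)
  obtain m where "m > 0" "even m" and m_le: "real m \<le> A * real n powr (1 / Q)"
    and ineq: "metric_cotype_ineq N e Q C n m"
    using cotype[of n] \<open>n > 0\<close> by auto
  have n_le: "real n \<le> (C * real m) powr Q"
    using metric_cotype_ineq_lower_bound[OF \<open>Metric_space N e\<close> ineq] \<open>m > 0\<close> \<open>even m\<close> \<open>C > 0\<close> \<open>Q > 0\<close> xy0
    by blast
  have "m > 7"
  proof (rule ccontr)
    assume "\<not> m > 7"
    then have "(C * real m) powr Q \<le> (C * 7) powr Q"
      using \<open>C > 0\<close> \<open>Q > 0\<close> by (intro powr_mono2) auto
    then show False using n_le n(2) by linarith
  qed
  have "real n powr (1 / Q) \<le> C * real m"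
  proof -
    have "real n powr (1 / Q) \<le> ((C * real m) powr Q) powr (1 / Q)"
      using n_le \<open>Q > 0\<close> by (intro powr_mono2) auto
    then show ?thesis using \<open>Q > 0\<close> \<open>C > 0\<close> by (simp add: powr_powr)
  qed
  then have "1 / real m \<le> C * real n powr (- 1 / Q)"
    using \<open>m > 0\<close> \<open>n > 0\<close> by (simp add: powr_minus field_simps)
  then have "2 * pi * real (2 * n) powr P * (1 / real m)
      \<le> 2 * pi * real (2 * n) powr P * (C * real n powr (- 1 / Q))"
    by (intro mult_left_mono) auto
  then have ratio: "2 * pi / real m * real (2 * n) powr P < t"
    using n(1) by (simp add: mult_ac)
  \<comment> \<open>The radius is chosen last, depending on \<open>n\<close> and \<open>m\<close>;
    it cancels from all ratios of distances.\<close>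
  obtain s where "s > 0" and sep: "\<And>x y. \<lbrakk>x \<in> torus n m; y \<in> torus n m; x \<noteq> y\<rbrakk> \<Longrightarrow>
      u (lp_dist p a (lp_circles a s n m x) + lp_dist p a (lp_circles a s n m y))
        < lp_dist p (lp_circles a s n m x) (lp_circles a s n m y)"
    using lp_circles_separated[OF u \<open>p \<ge> 1\<close> \<open>n > 0\<close> \<open>m > 0\<close>] by metis
  define F where "F = lp_circles a s n m"
  define h where "h x = the (f (Some (F x)))" for x
  have F_eq_iff: "F x = F y \<longleftrightarrow> x = y" if "x \<in> torus n m" "y \<in> torus n m" for x y
    using circles_inj[OF \<open>m > 0\<close> that] \<open>s > 0\<close>
    by (cases "x = y") (auto simp: F_def lp_circles_def fun_eq_iff[of "lp_circles _ _ _ _ _"])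
  have quasi_h: "h x \<in> N \<and> h y \<noteq> h z \<and> 
      e (h x) (h z) \<le> \<eta> (lp_dist p (F x) (F z) / lp_dist p (F y) (F z)) * e (h y) (h z)"
    if "x \<in> torus n m" "y \<in> torus n m" "z \<in> torus n m" "x \<noteq> y" "y \<noteq> z" "x \<noteq> z" for x y z
    unfolding h_def
  proof (rule quasi[of "F ` torus n m"])
    show "F ` torus n m \<subseteq> lp_space p"
      using lp_circles_in_lp_space[OF \<open>a \<in> lp_space p\<close>] by (auto simp: F_def)
  qed (use that sep F_eq_iff in \<open>auto simp: F_def\<close>)
  \<comment> \<open>The fact \<open>quasi_h\<close> speaks of three distinct points. The unit shift
    supplies the missing one where only membership in \<open>N\<close>, or distinctness of two
    images, is wanted.\<close>
  define \<epsilon>1 where "\<epsilon>1 = (\<lambda>i\<in>{..<n}. 1 :: int)"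
  have \<epsilon>1: "\<epsilon>1 \<in> sign_vectors n" by (auto simp: \<epsilon>1_def sign_vectors_def)
  have \<epsilon>1_move: "torus_add n m x \<epsilon>1 \<noteq> x" if "x \<in> torus n m" for x
  proof
    assume "torus_add n m x \<epsilon>1 = x"
    then have "(x 0 + 1) mod int m = x 0"
      using \<open>n > 0\<close> by (auto simp: torus_add_def \<epsilon>1_def fun_eq_iff dest: spec[of _ 0])
    then have "(x 0 + 1) mod int m = x 0 mod int m"
      by (metis mod_mod_trivial)
    then have "int m dvd 1" by (metis mod_eq_dvd_iff add_diff_cancel_left')
    then show False using \<open>m > 7\<close> by simp
  qed
  have antipode_far: "antipode n m j x \<noteq> x"
    "\<epsilon> \<in> sign_vectors n \<Longrightarrow> torus_add n m x \<epsilon> \<noteq> antipode n m j x"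
    "s \<le> lp_dist p (F (antipode n m j x)) (F x)" if j: "j < n" for x j \<epsilon>
  proof -
    obtain k where k: "\<bar>circles n m (antipode n m j x) k - circles n m x k\<bar> \<ge> 1"
      using circles_antipode[OF \<open>m > 0\<close> \<open>even m\<close> j] by blast
    then show "antipode n m j x \<noteq> x" by auto
    \<comment> \<open>A sign shift moves every circle coordinate by less than 1, whereas the
      antipode moves coordinate \<open>k\<close> by at least 1, so the two points differ.\<close>
    have "2 * pi / real m < 1" using \<open>m > 7\<close> pi_less_4 pi_approx by (simp add: field_simps)
    then show "torus_add n m x \<epsilon> \<noteq> antipode n m j x" if "\<epsilon> \<in> sign_vectors n"
      using k circles_step[OF \<open>m > 0\<close> that, of x k] by auto
    have "s \<le> s * \<bar>circles n m (antipode n m j x) k - circles n m x k\<bar>"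
      using k \<open>s > 0\<close> by simp
    also have "\<dots> \<le> lp_dist p (F (antipode n m j x)) (F x)"
      unfolding F_def using lp_dist_circles_ge[OF \<open>p \<ge> 1\<close>] \<open>s > 0\<close> by simp
    finally show "s \<le> lp_dist p (F (antipode n m j x)) (F x)" .
  qed
  note in_torus = torus_add_in_torus[OF \<open>m > 0\<close>]
  have "h \<in> torus n m \<rightarrow> N"
  proof
    fix x assume "x \<in> torus n m"
    then show "h x \<in> N"
      using quasi_h[of x "torus_add n m x \<epsilon>1" "antipode n m 0 x"] \<epsilon>1 \<epsilon>1_move
        antipode_far(1) antipode_far(2)[OF _ \<epsilon>1] \<open>n > 0\<close> in_torus by metis
  qed
  moreover have "h (antipode n m j x) \<noteq> h x" if "x \<in> torus n m" "j < n" for x j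
    using quasi_h[of "torus_add n m x \<epsilon>1" "antipode n m j x" x] \<epsilon>1 \<epsilon>1_move
      antipode_far(1) antipode_far(2)[OF _ \<epsilon>1] in_torus that by metis
  moreover have "e (h (torus_add n m x \<epsilon>)) (h x) \<le> \<delta> * e (h (antipode n m j x)) (h x)"
    if x: "x \<in> torus n m" and j: "j < n" and \<epsilon>: "\<epsilon> \<in> sign_vectors n" for x j \<epsilon>
  \<comment> \<open>A shift that fixes \<open>x\<close> contributes distance 0 and has to be set
    apart, because \<open>quasi_h\<close> needs distinct points.\<close>
  proof (cases "torus_add n m x \<epsilon> = x")
    case True
    then show ?thesis using \<open>h \<in> torus n m \<rightarrow> N\<close> x \<open>\<delta> > 0\<close> by (auto simp: Pi_iff)
  next
    case False
    \<comment> \<open>The aim is \<open>0 \<le> r\<close> and \<open>r < t\<close>, the range in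
      which \<open>\<eta>\<close> stays below \<open>\<delta>\<close>.\<close>
    define r where "r = lp_dist p (F (torus_add n m x \<epsilon>)) (F x) / lp_dist p (F (antipode n m j x)) (F x)"
    have far: "s \<le> lp_dist p (F (antipode n m j x)) (F x)" using antipode_far(3)[OF j] .
    have "lp_dist p (F (torus_add n m x \<epsilon>)) (F x) \<ge> s * \<bar>circles n m (torus_add n m x \<epsilon>) 0 - circles n m x 0\<bar>"
      unfolding F_def using lp_dist_circles_ge[OF \<open>p \<ge> 1\<close>] \<open>s > 0\<close> by simp
    then have nonneg: "lp_dist p (F (torus_add n m x \<epsilon>)) (F x) \<ge> 0"
      using \<open>s > 0\<close> by (smt (verit) mult_nonneg_nonneg)
    have "lp_dist p (F (torus_add n m x \<epsilon>)) (F x) \<le> s * (2 * pi / real m) * real (2 * n) powr P"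
      unfolding F_def P_def using \<open>s > 0\<close> \<open>n > 0\<close> \<open>p \<ge> 1\<close> circles_step[OF \<open>m > 0\<close> \<epsilon>]
      by (intro lp_dist_circles_le) auto
    also have "\<dots> < s * t" using mult_strict_left_mono[OF ratio \<open>s > 0\<close>] by (simp only: mult.assoc)
    also have "\<dots> \<le> lp_dist p (F (antipode n m j x)) (F x) * t"
      using far \<open>t > 0\<close> by simp
    finally have "r < t" using far \<open>s > 0\<close> by (simp add: r_def field_simps)
    moreover have "r \<ge> 0" using nonneg far \<open>s > 0\<close> by (simp add: r_def)
    ultimately have "\<eta> r < \<delta>" using t by blast
    have "e (h (torus_add n m x \<epsilon>)) (h x) \<le> \<eta> r * e (h (antipode n m j x)) (h x)"
      unfolding r_def
      using quasi_h[OF in_torus in_torus x antipode_far(2)[OF j \<epsilon>] antipode_far(1)[OF j] False]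
      by (rule conjunct2[THEN conjunct2])
    also have "\<dots> \<le> \<delta> * e (h (antipode n m j x)) (h x)"
      using \<open>\<eta> r < \<delta>\<close> by (intro mult_right_mono) auto
    finally show ?thesis .
  qed
  ultimately have "real n \<le> (\<delta> * C * real m) powr Q"
    using metric_cotype_ineq_contraction[OF \<open>Metric_space N e\<close> ineq \<open>m > 0\<close> \<open>n > 0\<close> \<open>C > 0\<close> \<open>Q > 0\<close> \<open>\<delta> > 0\<close>]
    by blast
  \<comment> \<open>Here the sharpness of the cotype, the upper bound on \<open>m\<close>, enters:
    the factor in front of n^(1/Q) becomes \<open>\<delta> * C * A\<close>, which is 1/2.\<close>
  also have "\<dots> \<le> (\<delta> * C * (A * real n powr (1 / Q))) powr Q"
    using m_le \<open>\<delta> > 0\<close> \<open>C > 0\<close> \<open>Q > 0\<close> by (intro powr_mono2 mult_left_mono) auto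
  also have "\<dots> = (1 / 2 * real n powr (1 / Q)) powr Q"
    using \<open>C > 0\<close> \<open>A > 0\<close> by (simp add: \<delta>_def)
  also have "\<dots> = (1 / 2) powr Q * real n"
    using \<open>Q > 0\<close> by (subst powr_mult) (auto simp: powr_powr)
  also have "\<dots> < 1 * real n"
    using \<open>Q > 0\<close> \<open>n > 0\<close> powr_less_mono2[of Q "1/2" 1] by (intro mult_strict_right_mono) auto
  finally show False by simp
qed

end
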